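(* Let $R$ be a non-singular, irreducible, aperiodic, positive recurrent homogeneous random walk in the quarter-plane, with interior transition probabilities $p_{s,t}$ and axis transition probabilities $h_s$, $v_t$. Let $\Gamma\subset U=(0,1)^2$ be such that for any $(\rho,\sigma)\in\Gamma$ there exists $(w,v)\in\mathbb{N}^2$ with $\tilde\rho^{w}\tilde\sigma^{v}\neq\rho^w\sigma^v$ for all $(\tilde\rho,\tilde\sigma)\in\Gamma\setminus\{(\rho,\sigma)\}$. Let the invariant measure of $R$ be $m(i,j)=\sum_{(\rho,\sigma)\in\Gamma}\alpha(\rho,\sigma)\rho^i\sigma^j$ with $|\Gamma|=\infty$, where $\alpha(\rho,\sigma)\in\mathbb{R}\setminus\{0\}$ for all $(\rho,\sigma)\in\Gamma$ and $\sum_{(\rho,\sigma)\in\Gamma}|\alpha(\rho,\sigma)|\frac{1}{1-\rho}\frac{1}{1-\sigma}<\infty$. Then $p_{1,0}=p_{1,1}=p_{0,1}=0$, and $\Gamma$ has a unique accumulation point, which is the origin $(0,0)$.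
   Context: Notation: $\mathbb{N}_0=\{0,1,2,\dots\}$, $\mathbb{N}=\{1,2,\dots\}$. Random walk. $R$ is a discrete-time Markov chain on $S=\{(i,j): i,j\in\mathbb{N}_0\}$; $p_{s,t}(i,j)$ is the probability of going from $(i,j)$ to $(i+s,j+t)$, and it is zero if $|s|>1$ or $|t|>1$. The interior is $\{i>0,j>0\}$, the horizontal axis is $\{i>0,j=0\}$, the vertical axis is $\{i=0,j>0\}$. The walk is homogeneous: for each two states $(i,j),(k,l)$ both in the interior (respectively both on the horizontal axis, both on the vertical axis), $p_{s,t}(i,j)=p_{s,t}(k,l)$ and $p_{s,t}(i-s,j-t)=p_{s,t}(k-s,l-t)$ for all $s,t\in\{-1,0,1\}$. For $i,j>0$ write $p_{s,t}=p_{s,t}(i,j)$, $h_s=p_{s,0}(i,0)$, $v_t=p_{0,t}(0,j)$. Consequently transitions from the horizontal axis into the row $j=1$ have probabilities $p_{s,1}$, transitions from the vertical axis into the column $i=1$ have probabilities $p_{1,t}$, and from the origin one goes to $(1,0),(0,1),(1,1)$ with probabilities $h_1,v_1,p_{1,1}$. Invariant measure. A positive finite measure $m$ on $S$ is invariant if it satisfies the balance equations, for all $i,j>0$: $m(i,j)=\sum_{s,t=-1}^{1}m(i-s,j-t)p_{s,t}$; $m(i,0)=\sum_{s=-1}^1 m(i-s,1)p_{s,-1}+\sum_{s=-1}^1 m(i-s,0)h_s$; $m(0,j)=\sum_{t=-1}^1 m(1,j-t)p_{-1,t}+\sum_{t=-1}^1 m(0,j-t)v_t$ (balance at the origin is implied).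 Singular walk. Let $Q(x,y)=xy\big(\sum_{s=-1}^{1}\sum_{t=-1}^{1}x^{-s}y^{-t}p_{s,t}-1\big)$, a polynomial. $R$ is singular if $Q(x,y)$ is reducible or of degree $1$ in at least one of the variables. Accumulation points of $\Gamma$ are taken in $\mathbb{R}^2$. *)

theory Defs
  imports "HOL-Probability.Probability" "HOL-Computational_Algebra.Computational_Algebra"
begin

section \<open>Markov chains on a discrete state space\<close>

text \<open>A chain is given by its transition kernel \<open>K\<close>; \<open>K s\<close> is the law of the next state after \<open>s\<close>.\<close>

primrec nstep :: "('s \<Rightarrow> 's pmf) \<Rightarrow> nat \<Rightarrow> 's \<Rightarrow> 's pmf" where
  "nstep K 0 s = return_pmf s"
| "nstep K (Suc n) s = bind_pmf (K s) (nstep K n)"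

definition irreducible_chain :: "('s \<Rightarrow> 's pmf) \<Rightarrow> bool" where
  "irreducible_chain K \<longleftrightarrow> (\<forall>s t. \<exists>n. pmf (nstep K n s) t > 0)"

definition aperiodic_chain :: "('s \<Rightarrow> 's pmf) \<Rightarrow> bool" where
  "aperiodic_chain K \<longleftrightarrow> (\<forall>s. Gcd {n. n > 0 \<and> pmf (nstep K n s) s > 0} = 1)"

text \<open>\<open>first_hit K n s t\<close> is the probability that the chain started in \<open>s\<close> is in \<open>t\<close> at time \<open>n\<close>
  and at none of the times \<open>1, \<dots>, n - 1\<close> (and \<open>0\<close> for \<open>n = 0\<close>), by conditioning on the first step.\<close>

primrec first_hit :: "('s \<Rightarrow> 's pmf) \<Rightarrow> nat \<Rightarrow> 's \<Rightarrow> 's \<Rightarrow> real" where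
  "first_hit K 0 s t = 0"
| "first_hit K (Suc n) s t =
     measure_pmf.expectation (K s)
       (\<lambda>u. if u = t then (if n = 0 then 1 else 0) else first_hit K n u t)"

text \<open>Return is almost sure, with finite expected return time.\<close>

definition positive_recurrent_chain :: "('s \<Rightarrow> 's pmf) \<Rightarrow> bool" where
  "positive_recurrent_chain K \<longleftrightarrow>
     (\<forall>s. (\<lambda>n. first_hit K n s s) sums 1 \<and> summable (\<lambda>n. real n * first_hit K n s s))"

section \<open>Homogeneous random walks in the quarter-plane\<close>

type_synonym walk = "nat \<times> nat \<Rightarrow> (nat \<times> nat) pmf"

text \<open>\<open>trans_prob R s t i j\<close> is $p_{s,t}(i,j)$, set to \<open>0\<close> if \<open>(i, j)\<close> or \<open>(i + s, j + t)\<close>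
  is outside the quarter-plane.\<close>

definition trans_prob :: "walk \<Rightarrow> int \<Rightarrow> int \<Rightarrow> int \<Rightarrow> int \<Rightarrow> real" where
  "trans_prob R s t i j =
     (if i \<ge> 0 \<and> j \<ge> 0 \<and> i + s \<ge> 0 \<and> j + t \<ge> 0
      then pmf (R (nat i, nat j)) (nat (i + s), nat (j + t)) else 0)"

definition interior_states :: "(int \<times> int) set" where
  "interior_states = {(i, j). i > 0 \<and> j > 0}"

definition horizontal_axis :: "(int \<times> int) set" where
  "horizontal_axis = {(i, j). i > 0 \<and> j = 0}"

definition vertical_axis :: "(int \<times> int) set" where
  "vertical_axis = {(i, j). i = 0 \<and> j > 0}"

definition homogeneous_walk :: "walk \<Rightarrow> bool" where
  "homogeneous_walk R \<longleftrightarrow>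
     (\<forall>s t i j. \<bar>s\<bar> > 1 \<or> \<bar>t\<bar> > 1 \<longrightarrow> trans_prob R s t i j = 0) \<and>
     (\<forall>C \<in> {interior_states, horizontal_axis, vertical_axis}.
        \<forall>(i, j) \<in> C. \<forall>(k, l) \<in> C. \<forall>s \<in> {-1, 0, 1}. \<forall>t \<in> {-1, 0, 1}.
          trans_prob R s t i j = trans_prob R s t k l \<and>
          trans_prob R s t (i - s) (j - t) = trans_prob R s t (k - s) (l - t))"

text \<open>The probabilities $p_{s,t}$, $h_s$, $v_t$. By homogeneity the representatives \<open>(1, 1)\<close>,
  \<open>(1, 0)\<close>, \<open>(0, 1)\<close> stand for all states of their region.\<close>

definition p_int :: "walk \<Rightarrow> int \<Rightarrow> int \<Rightarrow> real" where
  "p_int R s t = trans_prob R s t 1 1"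

definition p_hor :: "walk \<Rightarrow> int \<Rightarrow> real" where
  "p_hor R s = trans_prob R s 0 1 0"

definition p_ver :: "walk \<Rightarrow> int \<Rightarrow> real" where
  "p_ver R t = trans_prob R 0 t 0 1"

text \<open>A positive measure is taken to be nonnegative and not identically zero. The conversions to
  \<open>nat\<close> never truncate, since \<open>i, j > 0\<close>.\<close>

definition invariant_measure :: "walk \<Rightarrow> (nat \<times> nat \<Rightarrow> real) \<Rightarrow> bool" where
  "invariant_measure R m \<longleftrightarrow>
     (\<forall>z. m z \<ge> 0) \<and> (\<exists>z. m z > 0) \<and> m summable_on UNIV \<and>
     (\<forall>i j. i > 0 \<and> j > 0 \<longrightarrow>
        m (i, j) = (\<Sum>s\<in>{-1..1}. \<Sum>t\<in>{-1..1}. m (nat (int i - s), nat (int j - t)) * p_int R s t)) \<and>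
     (\<forall>i. i > 0 \<longrightarrow>
        m (i, 0) = (\<Sum>s\<in>{-1..1}. m (nat (int i - s), 1) * p_int R s (-1))
                 + (\<Sum>s\<in>{-1..1}. m (nat (int i - s), 0) * p_hor R s)) \<and>
     (\<forall>j. j > 0 \<longrightarrow>
        m (0, j) = (\<Sum>t\<in>{-1..1}. m (1, nat (int j - t)) * p_int R (-1) t)
                 + (\<Sum>t\<in>{-1..1}. m (0, nat (int j - t)) * p_ver R t))"

text \<open>\<open>Q_poly R\<close> is $Q(x,y) = xy(\sum_{s,t} x^{-s} y^{-t} p_{s,t} - 1)$, as a polynomial in \<open>y\<close>
  (outer variable) whose coefficients are real polynomials in \<open>x\<close> (inner variable).\<close>

definition Q_poly :: "walk \<Rightarrow> real poly poly" where
  "Q_poly R =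
     (\<Sum>s\<in>{-1..1}. \<Sum>t\<in>{-1..1}. monom (monom (p_int R s t) (nat (1 - s))) (nat (1 - t)))
     - monom (monom 1 1) 1"

lemma poly_Q_poly:
  assumes "x \<noteq> 0" "y \<noteq> 0"
  shows "poly (poly (Q_poly R) [:y:]) x =
    x * y * ((\<Sum>s\<in>{-1..1}. \<Sum>t\<in>{-1..1}. x powi (-s) * y powi (-t) * p_int R s t) - 1)"
proof -
  have *: "{-1..1} = {-1, 0, 1::int}"
    by auto
  show ?thesis
    using assms unfolding Q_poly_def *
    by (simp add: poly_monom power_int_def field_simps power2_eq_square)
qed

definition degree_y :: "real poly poly \<Rightarrow> nat" where
  "degree_y q = degree q"

definition degree_x :: "real poly poly \<Rightarrow> nat" where
  "degree_x q = (MAX n\<in>{..degree q}. degree (coeff q n))"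

text \<open>Reducibility is in the ring of real polynomials in \<open>x\<close> and \<open>y\<close>, so that factors depending on
  \<open>x\<close> only or on \<open>y\<close> only count as well. A polynomial that is reducible over the reals is reducible
  over the complex numbers, so non-singularity in this sense is implied by the complex version.\<close>

definition singular_walk :: "walk \<Rightarrow> bool" where
  "singular_walk R \<longleftrightarrow>
     \<not> irreducible (Q_poly R) \<or> degree_x (Q_poly R) = 1 \<or> degree_y (Q_poly R) = 1"

end

theory Submission
  imports Defs "HOL-Computational_Algebra.Field_as_Ring"
begin

text \<open>
  The balance equations are statements about moments. Testing them against the polynomials
  \<open>(1 - (x - r)\<^sup>2) ^ n\<close>, which converge to the indicator of \<open>r\<close>, separates the level sets of either
  coordinate: every point of \<open>\<Gamma>\<close> lies on the curve \<open>Q = 0\<close>, and a point that shares its first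
  (second) coordinate with no other point of \<open>\<Gamma>\<close> is also a zero of the horizontal (vertical)
  boundary form. Since \<open>Q\<close> is prime and the boundary form is linear in one variable, there are only
  finitely many such exceptional points.

  In logarithmic coordinates the curve is convex and passes through the origin, the image of
  \<open>(1, 1)\<close>. Hence a point of \<open>\<Gamma>\<close> never has both a point of the curve below it and one to its left, so from
  any point one can climb a staircase inside \<open>\<Gamma>\<close> until an exceptional point is met. Where
  \<open>x * y \<ge> \<epsilon>\<close>, two consecutive steps gain at least a constant \<open>c > 0\<close>, because the gradient of \<open>Q\<close> does
  not vanish on the curve. The staircases there are therefore of bounded length, and as each line meets
  the curve at most twice, only finitely many points of \<open>\<Gamma>\<close> have \<open>x * y \<ge> \<epsilon>\<close>. The only
  point of the curve left for accumulation is the origin, and \<open>Q\<close> near the origin forces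
  \<open>p\<^bsub>1,0\<^esub> = p\<^bsub>1,1\<^esub> = p\<^bsub>0,1\<^esub> = 0\<close>.
\<close>

section \<open>Moments and level sets\<close>

lemma has_sum_finite_sum:
  fixes f :: "'i \<Rightarrow> 'a \<Rightarrow> real"
  assumes "finite I" "\<And>i. i \<in> I \<Longrightarrow> (f i has_sum s i) A"
  shows "((\<lambda>a. \<Sum>i\<in>I. f i a) has_sum (\<Sum>i\<in>I. s i)) A"
  using assms by (induction I rule: finite_induct) (auto intro!: has_sum_add)

lemma has_sum_diff:
  fixes f g :: "'a \<Rightarrow> real"
  assumes "(f has_sum a) A" "(g has_sum b) A"
  shows "((\<lambda>x. f x - g x) has_sum (a - b)) A"
  using has_sum_add[OF assms(1), of "\<lambda>x. - g x" "- b"] assms(2) by (simp add: has_sum_uminus)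

lemma moments_imp_poly_moments:
  fixes c f :: "'a \<Rightarrow> real"
  assumes "\<And>n. ((\<lambda>a. c a * f a ^ n) has_sum 0) A"
  shows "((\<lambda>a. c a * poly q (f a)) has_sum 0) A"
proof -
  have "((\<lambda>a. \<Sum>n\<le>degree q. coeff q n * (c a * f a ^ n)) has_sum (\<Sum>n\<le>degree q. coeff q n * 0)) A"
    using assms by (intro has_sum_finite_sum has_sum_cmult_right) auto
  then show ?thesis
    by (simp add: poly_altdef sum_distrib_left mult_ac)
qed

text \<open>The factor \<open>(1 - (f a - r)\<^sup>2) ^ n\<close> is a polynomial in
  \<open>f a\<close>, so weighting by it keeps the sum at 0. It lies in [0, 1] and tends to the
  indicator of \<open>f a = r\<close>; dominated convergence does the rest.\<close>

lemma level_set_sum_eq_0: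
  fixes c f :: "'a \<Rightarrow> real"
  assumes f: "\<And>a. a \<in> A \<Longrightarrow> f a \<in> {0..1}" and r: "r \<in> {0..1}"
    and moments: "\<And>n. ((\<lambda>a. c a * f a ^ n) has_sum 0) A"
  shows "(c has_sum 0) {a \<in> A. f a = r}"
proof -
  let ?B = "{a \<in> A. f a = r}"
  have "c summable_on A"
    using moments[of 0] by (auto dest: has_sum_imp_summable)
  \<comment> \<open>\<open>infsetsum\<close> is an integral over \<open>count_space A\<close>, the
    form in which dominated convergence applies.\<close>
  then have c: "Infinite_Set_Sum.abs_summable_on c A"
    using summable_on_iff_abs_summable_on_real abs_summable_equivalent by blast
  define q where "q n a = (1 - (f a - r)\<^sup>2) ^ n" for n a
  have q01: "0 \<le> 1 - (f a - r)\<^sup>2" "1 - (f a - r)\<^sup>2 \<le> 1" if "a \<in> A" for a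
  proof -
    have "\<bar>f a - r\<bar> \<le> 1" using f[OF that] r by auto
    then show "0 \<le> 1 - (f a - r)\<^sup>2" by (simp add: abs_square_le_1)
  qed simp
  have q_poly: "q n a = poly ([:1 - r\<^sup>2, 2 * r, -1:] ^ n) (f a)" for n a
    by (simp add: q_def poly_power power2_eq_square algebra_simps)
  have dom: "norm (c a * q n a) \<le> norm (c a)" if "a \<in> A" for n a
    using q01[OF that] unfolding q_def abs_mult real_norm_def
    by (intro mult_left_le) (auto simp: power_le_one)
  have summ: "Infinite_Set_Sum.abs_summable_on (\<lambda>a. c a * q n a) A" for n
    using c dom by (rule Infinite_Set_Sum.abs_summable_on_comparison_test)
  have zero: "infsetsum (\<lambda>a. c a * q n a) A = 0" for n
    using moments_imp_poly_moments[OF moments] infsetsum_infsum[OF summ] unfolding q_poly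
    by (metis infsumI)
  have "(\<lambda>n. infsetsum (\<lambda>a. c a * q n a) A) \<longlonglongrightarrow> infsetsum (\<lambda>a. if f a = r then c a else 0) A"
    unfolding infsetsum_def
  proof (rule integral_dominated_convergence)
    show "integrable (count_space A) (\<lambda>a. norm (c a))"
      using c by (simp add: abs_summable_on_def)
    show "AE a in count_space A. (\<lambda>n. c a * q n a) \<longlonglongrightarrow> (if f a = r then c a else 0)"
    proof (rule AE_I2)
      fix a assume "a \<in> space (count_space A)"
      then have "a \<in> A" by simp
      show "(\<lambda>n. c a * q n a) \<longlonglongrightarrow> (if f a = r then c a else 0)"
      proof (cases "f a = r")
        case False
        then have "1 - (f a - r)\<^sup>2 < 1" by simp
        with q01[OF \<open>a \<in> A\<close>] have "(\<lambda>n. q n a) \<longlonglongrightarrow> 0"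
          unfolding q_def by (intro LIMSEQ_power_zero) auto
        from tendsto_mult_right_zero[OF this] False show ?thesis by simp
      qed (simp add: q_def)
    qed
  qed (use dom in auto)
  then have "infsetsum (\<lambda>a. if f a = r then c a else 0) A = 0"
    unfolding zero by (simp add: LIMSEQ_const_iff)
  moreover have *: "infsetsum (\<lambda>a. if f a = r then c a else 0) A = infsetsum c ?B"
    by (rule infsetsum_cong_neutral) auto
  moreover have cB: "Infinite_Set_Sum.abs_summable_on c ?B"
    using c by (rule Infinite_Set_Sum.abs_summable_on_subset) auto
  ultimately have "infsum c ?B = 0"
    by (simp add: infsetsum_infsum)
  moreover have "c summable_on ?B"
    using cB summable_on_iff_abs_summable_on_real abs_summable_equivalent by blast
  ultimately show ?thesis
    by (metis has_sum_infsum)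
qed

lemma has_sum_0_singletonD:
  fixes c :: "'a \<Rightarrow> real"
  assumes "(c has_sum 0) {a}"
  shows "c a = 0"
  using has_sum_finite[of "{a}" c] has_sum_unique[OF assms] by auto

text \<open>For each fixed \<open>j\<close> the powers of \<open>fst\<close> isolate the vertical
  line through \<open>x\<close>; on that line the powers of \<open>snd\<close> isolate
  \<open>y\<close>.\<close>

lemma double_moments_eq_0:
  fixes c :: "real \<times> real \<Rightarrow> real"
  assumes "\<Gamma> \<subseteq> {0..1} \<times> {0..1}" "(x, y) \<in> \<Gamma>"
    and "\<And>i j. ((\<lambda>z. c z * fst z ^ i * snd z ^ j) has_sum 0) \<Gamma>"
  shows "c (x, y) = 0"
proof -
  have *: "((\<lambda>z. c z * snd z ^ j) has_sum 0) {z \<in> \<Gamma>. fst z = x}" for j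
    using assms(1,2) assms(3)[of _ j]
    by (intro level_set_sum_eq_0[where f = fst]) (auto simp: mult_ac)
  have "(c has_sum 0) {z \<in> {z \<in> \<Gamma>. fst z = x}. snd z = y}"
    using assms(1,2) * by (intro level_set_sum_eq_0[where f = snd]) auto
  also have "{z \<in> {z \<in> \<Gamma>. fst z = x}. snd z = y} = {(x, y)}"
    using assms(2) by auto
  finally show ?thesis
    by (rule has_sum_0_singletonD)
qed

section \<open>The kernel and its convexity\<close>

text \<open>The coefficient of y^(1-t) in Q, before the term -xy is added: the exponent of x is
  1-s.\<close>

definition step_row :: "(int \<Rightarrow> int \<Rightarrow> real) \<Rightarrow> int \<Rightarrow> real \<Rightarrow> real" where
  "step_row p t x = p 1 t + p 0 t * x + p (-1) t * x\<^sup>2"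

text \<open>This is Q(x, y), arranged as a quadratic in y.\<close>

definition step_kernel :: "(int \<Rightarrow> int \<Rightarrow> real) \<Rightarrow> real \<Rightarrow> real \<Rightarrow> real" where
  "step_kernel p x y = step_row p 1 x + (step_row p 0 x - x) * y + step_row p (-1) x * y\<^sup>2"

text \<open>The partial derivative of Q in y. The one in x is
  \<open>kernel_dy (transp_steps p) y x\<close>.\<close>

definition kernel_dy :: "(int \<Rightarrow> int \<Rightarrow> real) \<Rightarrow> real \<Rightarrow> real \<Rightarrow> real" where
  "kernel_dy p x y = step_row p 0 x - x + 2 * step_row p (-1) x * y"

definition transp_steps :: "(int \<Rightarrow> int \<Rightarrow> real) \<Rightarrow> int \<Rightarrow> int \<Rightarrow> real" where
  [simp]: "transp_steps p s t = p t s"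

lemma kernel_transp: "step_kernel (transp_steps p) y x = step_kernel p x y"
  by (simp add: step_kernel_def step_row_def algebra_simps power2_eq_square)

lemma continuous_on_kernel [continuous_intros]:
  assumes "continuous_on S f" "continuous_on S g"
  shows "continuous_on S (\<lambda>z. step_kernel p (f z) (g z))"
  unfolding step_kernel_def step_row_def by (intro continuous_intros assms)

lemma continuous_on_kernel_dy [continuous_intros]:
  assumes "continuous_on S f" "continuous_on S g"
  shows "continuous_on S (\<lambda>z. kernel_dy p (f z) (g z))"
  unfolding kernel_dy_def step_row_def by (intro continuous_intros assms)

text \<open>The derivative of a quadratic at a root is the leading coefficient times the difference
  of the two roots.\<close>

lemma kernel_dy_chord:
  assumes "step_kernel p x y = 0" "step_kernel p x y' = 0" "y \<noteq> y'"
  shows "kernel_dy p x y = step_row p (-1) x * (y - y')"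
proof -
  have "step_kernel p x y - step_kernel p x y' = (y - y') * (step_row p 0 x - x + step_row p (-1) x * (y + y'))"
    by (simp add: step_kernel_def algebra_simps power2_eq_square)
  with assms have "step_row p 0 x - x + step_row p (-1) x * (y + y') = 0"
    by simp
  then show ?thesis
    by (simp add: kernel_dy_def algebra_simps)
qed

section \<open>Tangent inequality in logarithmic coordinates\<close>

text \<open>With a = s ln r + t ln u this is exp a - 1 - a, the gap between the exponential and its
  tangent at 0. It is nonnegative and vanishes only for a = 0.\<close>

definition excess :: "real \<Rightarrow> real \<Rightarrow> int \<Rightarrow> int \<Rightarrow> real" where
  "excess r u s t = r powi s * u powi t - 1 - (s * ln r + t * ln u)"

lemma ln_monomial:
  fixes r u :: real
  assumes "r > 0" "u > 0" "s \<in> {-1, 0, 1}" "t \<in> {-1, 0, 1}"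
  shows "ln (r powi s * u powi t) = s * ln r + t * ln u"
  using assms by (auto simp: power_int_def ln_mult ln_inverse)

lemma excess_nonneg:
  assumes "r > 0" "u > 0" "s \<in> {-1, 0, 1}" "t \<in> {-1, 0, 1}"
  shows "excess r u s t \<ge> 0"
  using ln_le_minus_one[of "r powi s * u powi t"] assms
  by (simp add: ln_monomial excess_def)

lemma excess_eq_0D:
  assumes "r > 0" "u > 0" "s \<in> {-1, 0, 1}" "t \<in> {-1, 0, 1}" "excess r u s t = 0"
  shows "s * ln r + t * ln u = 0"
proof -
  let ?z = "r powi s * u powi t"
  have pos: "?z > 0" using assms by simp
  have "ln ?z = ?z - 1"
    using assms by (simp add: ln_monomial excess_def)
  then have "?z = 1" using pos ln_eq_minus_one by blast
  then show ?thesis using ln_monomial[OF assms(1-4)] by simp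
qed

text \<open>In logarithmic coordinates, \<open>1 + step_kernel p x y / (x * y)\<close> is a convex function; this is its
  tangent inequality, with the error term made explicit.\<close>

lemma kernel_tangent:
  assumes "x > 0" "y > 0" "x' > 0" "y' > 0" "step_kernel p x y = 0" "step_kernel p x' y' = 0"
  shows "(\<Sum>s\<in>{-1,0,1}. \<Sum>t\<in>{-1,0,1}.
            p s t * x ^ nat (1 - s) * y ^ nat (1 - t) * excess (x / x') (y / y') s t) =
         ln (x / x') * x * kernel_dy (transp_steps p) y x + ln (y / y') * y * kernel_dy p x y"
proof -
  define r u where "r = x / x'" and "u = y / y'"
  define L M where "L = ln r" and "M = ln u"
  have xy: "x = r * x'" "y = u * y'" and pos: "r > 0" "u > 0"
    using assms by (auto simp: r_def u_def)
  let ?S = "\<lambda>f::int \<Rightarrow> int \<Rightarrow> real. \<Sum>s\<in>{-1,0,1}. \<Sum>t\<in>{-1,0,1}. p s t * x ^ nat (1 - s) * y ^ nat (1 - t) * f s t"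
  \<comment> \<open>Since x = r x', the weight r^s turns x^(1-s) into r x'^(1-s), and likewise in y;
    the sum becomes that of the other zero.\<close>
  have 1: "?S (\<lambda>s t. r powi s * u powi t) = r * u * (step_kernel p x' y' + x' * y')"
    using pos unfolding xy step_kernel_def step_row_def
    by (simp add: power_int_def field_simps power2_eq_square)
  have 2: "?S (\<lambda>s t. 1) = step_kernel p x y + x * y"
    unfolding step_kernel_def step_row_def by (simp add: field_simps power2_eq_square)
  have 3: "?S (\<lambda>s t. s * L + t * M) =
      (L + M) * step_kernel p x y - L * x * kernel_dy (transp_steps p) y x - M * y * kernel_dy p x y"
    unfolding step_kernel_def kernel_dy_def step_row_def by (simp add: field_simps power2_eq_square)
  have "?S (excess r u) = ?S (\<lambda>s t. r powi s * u powi t) - ?S (\<lambda>s t. 1) - ?S (\<lambda>s t. s * L + t * M)"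
    unfolding excess_def L_def M_def
    by (simp only: sum_subtractf [symmetric] right_diff_distrib mult_1_right)
  also have "\<dots> = L * x * kernel_dy (transp_steps p) y x + M * y * kernel_dy p x y"
    unfolding 1 2 3 using assms(5,6) xy by simp
  finally show ?thesis unfolding r_def u_def L_def M_def .
qed

lemma islimpt_closed_superset:
  assumes "z islimpt \<Gamma>" "\<Gamma> \<subseteq> C" "closed C"
  shows "z \<in> C"
  using assms by (meson closed_limpt islimpt_subset)

text \<open>What the analysis takes from non-singularity. \<open>south\<close> and
  \<open>north\<close> make the leading and constant coefficients of Q in y positive for x > 0,
  \<open>west\<close> and \<open>east\<close> do the same in x, and \<open>spanning\<close> gives
  strict convexity in logarithmic coordinates.\<close>

locale quarter_plane_kernel =
  fixes p :: "int \<Rightarrow> int \<Rightarrow> real"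
  assumes nonneg: "p s t \<ge> 0"
    and sum_1: "(\<Sum>s\<in>{-1,0,1}. \<Sum>t\<in>{-1,0,1}. p s t) = 1"
    and south: "\<exists>s\<in>{-1,0,1}. p s (-1) > 0"
    and north: "\<exists>s\<in>{-1,0,1}. p s 1 > 0"
    and west: "\<exists>t\<in>{-1,0,1}. p (-1) t > 0"
    and east: "\<exists>t\<in>{-1,0,1}. p 1 t > 0"
    and spanning: "a \<noteq> 0 \<or> b \<noteq> 0 \<Longrightarrow>
      \<exists>s\<in>{-1,0,1}. \<exists>t\<in>{-1,0,1}. p s t > 0 \<and> s * a + t * b \<noteq> (0 :: real)"
begin

lemma transp: "quarter_plane_kernel (transp_steps p)"
proof
  show "\<exists>s\<in>{-1,0,1}. \<exists>t\<in>{-1,0,1}. transp_steps p s t > 0 \<and> s * a + t * b \<noteq> 0"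
    if "a \<noteq> 0 \<or> b \<noteq> 0" for a b :: real
    using spanning[of b a] that by (auto simp: add.commute)
  show "(\<Sum>s\<in>{-1,0,1}. \<Sum>t\<in>{-1,0,1}. transp_steps p s t) = 1"
    using sum_1 by (simp add: algebra_simps)
qed (use nonneg south north west east in auto)

lemma row_pos:
  assumes "x > 0" "\<exists>s\<in>{-1,0,1}. p s t > 0"
  shows "step_row p t x > 0"
proof -
  have "p 1 t \<ge> 0" "p 0 t * x \<ge> 0" "p (-1) t * x\<^sup>2 \<ge> 0"
    using nonneg assms(1) by auto
  moreover have "p 1 t > 0 \<or> p 0 t * x > 0 \<or> p (-1) t * x\<^sup>2 > 0"
    using assms by auto
  ultimately show ?thesis unfolding step_row_def by linarith
qed

lemma row_le_1:
  assumes "0 \<le> x" "x \<le> 1"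
  shows "step_row p (-1) x \<le> 1"
proof -
  have "p 0 (-1) * x \<le> p 0 (-1)" "p (-1) (-1) * x\<^sup>2 \<le> p (-1) (-1)"
    using nonneg assms by (auto intro!: mult_left_le simp: power_le_one)
  moreover have "p s t \<ge> 0" for s t by (rule nonneg)
  then have "p 1 (-1) + p 0 (-1) + p (-1) (-1) \<le> 1"
    using sum_1 by (simp, smt (verit))
  ultimately show ?thesis unfolding step_row_def by simp
qed

lemma kernel_1_1: "step_kernel p 1 1 = 0"
  using sum_1 by (simp add: step_kernel_def step_row_def)

lemma tangent_nonneg:
  assumes "x > 0" "y > 0" "x' > 0" "y' > 0" "step_kernel p x y = 0" "step_kernel p x' y' = 0"
  shows "ln (x / x') * x * kernel_dy (transp_steps p) y x + ln (y / y') * y * kernel_dy p x y \<ge> 0"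
  unfolding kernel_tangent[OF assms, symmetric]
  using assms nonneg by (intro sum_nonneg mult_nonneg_nonneg excess_nonneg) auto

text \<open>The tangent at such a corner would separate it from the zero \<open>(1, 1)\<close>.\<close>

lemma no_lower_corner:
  assumes "0 < x" "x < 1" "0 < y" "y < 1" "x' < x" "y' < y"
    and "step_kernel p x y = 0" "step_kernel p x' y = 0" "step_kernel p x y' = 0"
  shows False
proof -
  interpret T: quarter_plane_kernel "transp_steps p" by (rule transp)
  \<comment> \<open>The other zero on each line is smaller, so by the chord formula both partial
    derivatives are positive.\<close>
  have "kernel_dy p x y > 0"
    using kernel_dy_chord[OF assms(7,9)] row_pos[OF assms(1) south] assms by simp
  moreover have "kernel_dy (transp_steps p) y x > 0"
    using kernel_dy_chord[of "transp_steps p" y x x'] T.row_pos[OF assms(3) T.south] assms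
    by (simp add: kernel_transp)
  moreover have "ln x < 0" "ln y < 0" using assms by auto
  ultimately have "ln x * x * kernel_dy (transp_steps p) y x < 0" "ln y * y * kernel_dy p x y < 0"
    using assms by (simp_all add: mult_neg_pos)
  with tangent_nonneg[of x y 1 1] kernel_1_1 assms show False by simp
qed

text \<open>A critical point at level 0 of a strictly convex function is its only zero, so a second
  zero excludes it. Concretely, every \<open>excess\<close> term of positive probability would
  vanish, against \<open>spanning\<close> in the direction joining the two zeros.\<close>

lemma gradient_nonzero:
  assumes "x > 0" "y > 0" "step_kernel p x y = 0"
    and "x' > 0" "y' > 0" "step_kernel p x' y' = 0" "(x', y') \<noteq> (x, y)"
  shows "kernel_dy p x y \<noteq> 0 \<or> kernel_dy (transp_steps p) y x \<noteq> 0"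
proof (rule ccontr)
  assume *: "\<not> ?thesis"
  define w where "w s t = p s t * x ^ nat (1 - s) * y ^ nat (1 - t) * excess (x / x') (y / y') s t"
    for s t
  define I :: "int set" where "I = {-1,0,1}"
  have I: "finite I" by (simp add: I_def)
  have nn: "w s t \<ge> 0" if "s \<in> I" "t \<in> I" for s t
    unfolding w_def using assms nonneg that
    by (intro mult_nonneg_nonneg excess_nonneg) (auto simp: I_def)
  have "(\<Sum>s\<in>I. \<Sum>t\<in>I. w s t) = 0"
    unfolding w_def I_def using kernel_tangent[of x y x' y' p] * assms by simp
  then have inner: "(\<Sum>t\<in>I. w s t) = 0" if "s \<in> I" for s
    using that nn I by (subst (asm) sum_nonneg_eq_0_iff) (auto intro!: sum_nonneg)
  have w0: "w s t = 0" if "s \<in> I" "t \<in> I" for s t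
    by (rule sum_nonneg_0[OF I _ inner[OF that(1)] that(2)]) (rule nn[OF that(1)])
  have "ln (x / x') \<noteq> 0 \<or> ln (y / y') \<noteq> 0"
    using assms by auto
  from spanning[OF this] obtain s t where st: "s \<in> {-1,0,1}" "t \<in> {-1,0,1}" "p s t > 0"
    "s * ln (x / x') + t * ln (y / y') \<noteq> 0"
    by blast
  then have "excess (x / x') (y / y') s t = 0"
    using w0[of s t] assms by (simp add: I_def w_def)
  with st assms show False
    using excess_eq_0D[of "x / x'" "y / y'" s t] by simp
qed

text \<open>The partial derivative at a zero of the kernel is bounded by the distance to the other zero
  on the same line, so two consecutive steps of a staircase cannot both be short.\<close>

lemma staircase_gap:
  assumes "\<epsilon> > 0" "x\<^sub>1 > 0" "y\<^sub>1 > 0" "x\<^sub>2 > 0" "y\<^sub>2 > 0" "(x\<^sub>1, y\<^sub>1) \<noteq> (x\<^sub>2, y\<^sub>2)"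
    and "step_kernel p x\<^sub>1 y\<^sub>1 = 0" "step_kernel p x\<^sub>2 y\<^sub>2 = 0"
  obtains c where "c > 0"
    "\<And>x y x' y'. \<lbrakk>0 < x; x \<le> 1; 0 < y; y \<le> 1; x * y \<ge> \<epsilon>; x' \<noteq> x; y' \<noteq> y;
       step_kernel p x y = 0; step_kernel p x' y = 0; step_kernel p x y' = 0\<rbrakk> \<Longrightarrow> c \<le> \<bar>x - x'\<bar> + \<bar>y - y'\<bar>"
proof -
  interpret T: quarter_plane_kernel "transp_steps p" by (rule transp)
  define K where "K = ({0..1} \<times> {0..1}) \<inter> {z. \<epsilon> \<le> fst z * snd z} \<inter> {z. step_kernel p (fst z) (snd z) = 0}"
  define g where "g z = \<bar>kernel_dy p (fst z) (snd z)\<bar> + \<bar>kernel_dy (transp_steps p) (snd z) (fst z)\<bar>" for z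
  have "closed {z. \<epsilon> \<le> fst z * snd z}" "closed {z. step_kernel p (fst z) (snd z) = 0}"
    by (intro closed_Collect_le closed_Collect_eq continuous_intros)+
  then have K: "compact K"
    unfolding K_def by (intro compact_Int_closed compact_Times) auto
  have g: "continuous_on K g"
    unfolding g_def by (intro continuous_intros)
  have pos: "fst z > 0" "snd z > 0" if "z \<in> K" for z
  proof -
    have "fst z * snd z > 0" "fst z \<ge> 0" "snd z \<ge> 0"
      using that assms(1) by (auto simp: K_def)
    then show "fst z > 0" "snd z > 0"
      by (auto simp: zero_less_mult_iff)
  qed
  have g_pos: "g z > 0" if "z \<in> K" for z
  proof -
    \<comment> \<open>Of two distinct zeros, at least one differs from \<open>z\<close>.\<close>
    have "\<exists>x' y'. x' > 0 \<and> y' > 0 \<and> step_kernel p x' y' = 0 \<and> (x', y') \<noteq> (fst z, snd z)"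
      using assms by metis
    then have "kernel_dy p (fst z) (snd z) \<noteq> 0 \<or> kernel_dy (transp_steps p) (snd z) (fst z) \<noteq> 0"
      using gradient_nonzero[of "fst z" "snd z"] pos[OF that] that by (auto simp: K_def)
    then show ?thesis unfolding g_def by linarith
  qed
  obtain c where c: "c > 0" "\<And>z. z \<in> K \<Longrightarrow> c \<le> g z"
  proof (cases "K = {}")
    case True
    then show ?thesis by (intro that[of 1]) auto
  next
    case False
    then obtain z where "z \<in> K" "\<And>w. w \<in> K \<Longrightarrow> g z \<le> g w"
      using continuous_attains_inf[OF K _ g] by blast
    then show ?thesis using g_pos by (intro that[of "g z"]) auto
  qed
  show ?thesis
  proof (rule that[OF c(1)])
    fix x y x' y' :: real
    assume *: "0 < x" "x \<le> 1" "0 < y" "y \<le> 1" "x * y \<ge> \<epsilon>" "x' \<noteq> x" "y' \<noteq> y"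
      "step_kernel p x y = 0" "step_kernel p x' y = 0" "step_kernel p x y' = 0"
    have a: "kernel_dy p x y = step_row p (-1) x * (y - y')"
      "kernel_dy (transp_steps p) y x = step_row (transp_steps p) (-1) y * (x - x')"
      using * by (auto intro!: kernel_dy_chord simp: kernel_transp)
    have "\<bar>step_row p (-1) x\<bar> \<le> 1" "\<bar>step_row (transp_steps p) (-1) y\<bar> \<le> 1"
      using row_le_1[of x] T.row_le_1[of y] row_pos[OF _ south, of x] T.row_pos[OF _ T.south, of y] *
      by auto
    then have "g (x, y) \<le> 1 * \<bar>y - y'\<bar> + 1 * \<bar>x - x'\<bar>"
      unfolding g_def a fst_conv snd_conv abs_mult by (intro add_mono mult_right_mono) auto
    moreover have "c \<le> g (x, y)"
      using * by (intro c) (auto simp: K_def)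
    ultimately show "c \<le> \<bar>x - x'\<bar> + \<bar>y - y'\<bar>" by simp
  qed
qed

section \<open>Finiteness of \<Gamma> away from the axes\<close>

lemma finite_zeros_y:
  assumes "x > 0"
  shows "finite {y. step_kernel p x y = 0}"
proof -
  have "[:step_row p 1 x, step_row p 0 x - x, step_row p (-1) x:] \<noteq> 0"
    using row_pos[OF assms south] by auto
  from poly_roots_finite[OF this] show ?thesis
    by (rule finite_subset[rotated]) (auto simp: step_kernel_def algebra_simps power2_eq_square)
qed

lemma finite_zeros_x:
  assumes "y > 0"
  shows "finite {x. step_kernel p x y = 0}"
proof -
  interpret T: quarter_plane_kernel "transp_steps p" by (rule transp)
  show ?thesis using T.finite_zeros_y[OF assms] by (simp add: kernel_transp)
qed

lemma finite_away_from_axes: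
  assumes sub: "\<Gamma> \<subseteq> {0<..<1} \<times> {0<..<1}" and inf: "infinite \<Gamma>"
    and zero: "\<And>x y. (x, y) \<in> \<Gamma> \<Longrightarrow> step_kernel p x y = 0"
    and E: "finite E"
    and mates: "\<And>x y. (x, y) \<in> \<Gamma> - E \<Longrightarrow>
      (\<exists>x'. x' \<noteq> x \<and> (x', y) \<in> \<Gamma>) \<and> (\<exists>y'. y' \<noteq> y \<and> (x, y') \<in> \<Gamma>)"
    and eps: "\<epsilon> > 0"
  shows "finite {z \<in> \<Gamma>. \<epsilon> \<le> fst z * snd z}"
proof -
  have bounds: "0 < x" "x < 1" "0 < y" "y < 1" if "(x, y) \<in> \<Gamma>" for x y
    using that sub by auto
  obtain x1 y1 where 1: "(x1, y1) \<in> \<Gamma>"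
    using inf by (metis ex_in_conv finite.emptyI surj_pair)
  have "infinite (\<Gamma> - {(x1, y1)})" using inf by simp
  then obtain x2 y2 where 2: "(x2, y2) \<in> \<Gamma> - {(x1, y1)}"
    by (metis ex_in_conv finite.emptyI surj_pair)
  obtain c where c: "c > 0"
    "\<And>x y x' y'. \<lbrakk>0 < x; x \<le> 1; 0 < y; y \<le> 1; x * y \<ge> \<epsilon>; x' \<noteq> x; y' \<noteq> y;
       step_kernel p x y = 0; step_kernel p x' y = 0; step_kernel p x y' = 0\<rbrakk> \<Longrightarrow> c \<le> \<bar>x - x'\<bar> + \<bar>y - y'\<bar>"
    using staircase_gap[OF eps, of x1 y1 x2 y2] 1 2 bounds[OF 1] bounds[of x2 y2] zero by auto
  \<comment> \<open>\<open>nb\<close> undoes one staircase step: the point before the step shares a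
    line with the point after it, and each line carries finitely many zeros.\<close>
  define nb where "nb S = {z \<in> \<Gamma>. \<exists>w\<in>S. fst z = fst w \<or> snd z = snd w}" for S
  have nb_finite: "finite (nb S)" if "finite S" "S \<subseteq> \<Gamma>" for S
  proof (rule finite_subset)
    show "nb S \<subseteq> (\<Union>w\<in>S. {fst w} \<times> {y. step_kernel p (fst w) y = 0} \<union> {x. step_kernel p x (snd w) = 0} \<times> {snd w})"
      using zero by (force simp: nb_def)
    show "finite \<dots>"
      using that sub by (intro finite_UN_I finite_UnI finite_cartesian_product finite_zeros_x
          finite_zeros_y) auto
  qed
  \<comment> \<open>Two staircase steps raise x + y by at least \<open>c\<close>, so
    \<open>k\<close> bounds the number of double steps still possible. \<open>F 0\<close> is empty
    because x + y < 2 on \<Gamma>.\<close>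
  define F where "F k = {z \<in> \<Gamma>. \<epsilon> \<le> fst z * snd z \<and> 2 - real k * c < fst z + snd z}" for k
  have F_finite: "finite (F k)" for k
  proof (induction k)
    case 0
    have "F 0 = {}" using sub by (force simp: F_def)
    then show ?case by simp
  next
    case (Suc k)
    have "F (Suc k) \<subseteq> (E \<inter> \<Gamma>) \<union> nb (E \<inter> \<Gamma>) \<union> nb (nb (F k))"
    proof
      fix z assume z: "z \<in> F (Suc k)"
      obtain x y where xy: "z = (x, y)" by (cases z)
      have G: "(x, y) \<in> \<Gamma>" and eps_xy: "\<epsilon> \<le> x * y" and big: "2 - real k * c < x + y + c"
        using z xy by (auto simp: F_def algebra_simps)
      note b = bounds[OF G]
      show "z \<in> (E \<inter> \<Gamma>) \<union> nb (E \<inter> \<Gamma>) \<union> nb (nb (F k))"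
      proof (cases "(x, y) \<in> E")
        case True
        then show ?thesis using G xy by simp
      next
        case False
        then obtain x' y' where m: "x' \<noteq> x" "(x', y) \<in> \<Gamma>" "y' \<noteq> y" "(x, y') \<in> \<Gamma>"
          using mates G by blast
        \<comment> \<open>The mates cannot both be smaller, so a step to the right or upwards
          exists.\<close>
        have "\<not> (x' < x \<and> y' < y)"
          using no_lower_corner b m G zero by blast
        then consider "x < x'" | "y < y'" using m by linarith
        then show ?thesis
        proof cases
          case 1
          note b' = bounds[OF m(2)]
          have "x * y \<le> x' * y" using 1 b by simp
          then have eps': "\<epsilon> \<le> x' * y" using eps_xy by linarith
          show ?thesis
          proof (cases "(x', y) \<in> E")
            case True
            then show ?thesis using G xy m by (force simp: nb_def)
          next
            case False
            then obtain w where w: "w \<noteq> y" "(x', w) \<in> \<Gamma>"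
              using mates m by blast
            \<comment> \<open>The point just left lies to the left of (x', y), so the vertical mate
              of (x', y) must lie above. The product of the coordinates only grows, which keeps the
              bound by \<epsilon>.\<close>
            have "\<not> w < y"
              using no_lower_corner[OF b' 1, of w] w m G zero by blast
            then have yw: "y < w" using w by linarith
            \<comment> \<open>The gap is applied at the corner (x', y), between the two
              steps.\<close>
            have "c \<le> \<bar>x' - x\<bar> + \<bar>y - w\<bar>"
              using c(2)[of x' y x w] b' eps' 1 w m G zero by auto
            then have "2 - real k * c < x' + w" using big 1 yw by linarith
            moreover have "x' * y \<le> x' * w" using b' yw by simp
            then have "\<epsilon> \<le> x' * w" using eps' by linarith
            ultimately have "(x', w) \<in> F k" using w by (simp add: F_def)
            then show ?thesis using w m G xy by (force simp: nb_def)
          qed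
        next
          case 2
          note b' = bounds[OF m(4)]
          have "x * y \<le> x * y'" using 2 b by simp
          then have eps': "\<epsilon> \<le> x * y'" using eps_xy by linarith
          show ?thesis
          proof (cases "(x, y') \<in> E")
            case True
            then show ?thesis using G xy m by (force simp: nb_def)
          next
            case False
            then obtain w where w: "w \<noteq> x" "(w, y') \<in> \<Gamma>"
              using mates m by blast
            have "\<not> w < x"
              using no_lower_corner[OF b' _ 2, of w] w m G zero by blast
            then have xw: "x < w" using w by linarith
            have "c \<le> \<bar>x - w\<bar> + \<bar>y' - y\<bar>"
              using c(2)[of x y' w y] b' eps' 2 w m G zero by auto
            then have "2 - real k * c < w + y'" using big 2 xw by linarith
            moreover have "x * y' \<le> w * y'" using b' xw by simp
            then have "\<epsilon> \<le> w * y'" using eps' by linarith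
            ultimately have "(w, y') \<in> F k" using w by (simp add: F_def)
            then show ?thesis using w m G xy by (force simp: nb_def)
          qed
        qed
      qed
    qed
    moreover have "finite \<dots>"
      using Suc E by (intro finite_UnI nb_finite) (auto simp: nb_def F_def)
    ultimately show ?case by (rule finite_subset)
  qed
  \<comment> \<open>Once k c > 2, the condition on x + y in \<open>F k\<close> holds throughout
    \<Gamma>.\<close>
  obtain k :: nat where "2 / c < real k" using reals_Archimedean2 by blast
  then have "2 < real k * c" using c(1) by (simp add: field_simps)
  then have "{z \<in> \<Gamma>. \<epsilon> \<le> fst z * snd z} \<subseteq> F k"
    using sub by (force simp: F_def)
  then show ?thesis using F_finite finite_subset by blast
qed

section \<open>Accumulation points and the vanishing probabilities\<close>

text \<open>Existence is compactness of the closed square. \<open>away\<close> excludes limits with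
  positive coordinates, and Q is positive on the open positive half-axes.\<close>

lemma limit_points_origin:
  assumes sub: "\<Gamma> \<subseteq> {0<..<1} \<times> {0<..<1}" and inf: "infinite \<Gamma>"
    and zero: "\<And>x y. (x, y) \<in> \<Gamma> \<Longrightarrow> step_kernel p x y = 0"
    and away: "\<And>\<epsilon>. \<epsilon> > 0 \<Longrightarrow> finite {z \<in> \<Gamma>. \<epsilon> \<le> fst z * snd z}"
  shows "(0, 0) islimpt \<Gamma> \<and> (\<forall>z. z islimpt \<Gamma> \<longrightarrow> z = (0, 0))"
proof -
  interpret T: quarter_plane_kernel "transp_steps p" by (rule transp)
  have origin: "z = (0, 0)" if z: "z islimpt \<Gamma>" for z
  proof -
    have "z \<in> {0..1} \<times> {0..1}"
      by (rule islimpt_closed_superset[OF z]) (use sub in \<open>auto intro!: closed_Times\<close>)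
    then have nn: "fst z \<ge> 0" "snd z \<ge> 0" by auto
    have "closed {z. step_kernel p (fst z) (snd z) = 0}"
      by (intro closed_Collect_eq continuous_intros)
    then have "z \<in> {z. step_kernel p (fst z) (snd z) = 0}"
      by (rule islimpt_closed_superset[OF z, rotated]) (use zero in auto)
    then have k: "step_kernel p (fst z) (snd z) = 0" by simp
    have "\<not> fst z * snd z > 0"
    proof
      assume *: "fst z * snd z > 0"
      let ?e = "fst z * snd z / 2"
      define U where "U = {w::real \<times> real. ?e < fst w * snd w}"
      have "open U"
        unfolding U_def by (intro open_Collect_less continuous_intros)
      moreover have "z \<in> U" using * by (simp add: U_def)
      ultimately have "infinite (U \<inter> \<Gamma>)"
        using z islimpt_eq_acc_point[of z \<Gamma>] by simp
      moreover have "U \<inter> \<Gamma> \<subseteq> {w \<in> \<Gamma>. ?e \<le> fst w * snd w}" by (auto simp: U_def)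
      moreover have "finite {w \<in> \<Gamma>. ?e \<le> fst w * snd w}" by (rule away) (use * in simp)
      ultimately show False using finite_subset by metis
    qed
    \<comment> \<open>For y = 0 only the constant coefficient \<open>step_row p 1\<close> of Q
      remains, which is positive by \<open>north\<close>.\<close>
    moreover have "snd z \<noteq> 0" if "fst z > 0"
      using row_pos[OF that north] k by (auto simp: step_kernel_def)
    moreover have "fst z \<noteq> 0" if "snd z > 0"
    proof -
      have "step_kernel (transp_steps p) (snd z) (fst z) = 0" using k by (simp add: kernel_transp)
      then show ?thesis using T.row_pos[OF that T.north] by (auto simp: step_kernel_def)
    qed
    ultimately have "fst z = 0" "snd z = 0"
      using nn by (metis less_eq_real_def mult_pos_pos)+
    then show ?thesis by (simp add: prod_eq_iff)
  qed
  have "compact ({0..1::real} \<times> {0..1::real})" by (intro compact_Times) auto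
  moreover have "\<Gamma> \<subseteq> {0..1} \<times> {0..1}" using sub by auto
  ultimately obtain z where "z islimpt \<Gamma>"
    using inf Heine_Borel_imp_Bolzano_Weierstrass by blast
  with origin show ?thesis by metis
qed

text \<open>Moving xy to the other side of Q = 0 and dropping nonnegative terms bounds each of the
  three probabilities by a coordinate on \<Gamma>. These are closed conditions, so they hold at the
  origin too.\<close>

lemma no_northeast_steps:
  assumes sub: "\<Gamma> \<subseteq> {0<..<1} \<times> {0<..<1}"
    and zero: "\<And>x y. (x, y) \<in> \<Gamma> \<Longrightarrow> step_kernel p x y = 0"
    and lim: "(0, 0) islimpt \<Gamma>"
  shows "p 1 0 = 0 \<and> p 1 1 = 0 \<and> p 0 1 = 0"
proof -
  have bound: "p 1 0 \<le> x \<and> p 0 1 \<le> y \<and> p 1 1 \<le> x" if "(x, y) \<in> \<Gamma>" for x y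
  proof -
    have xy: "0 < x" "0 < y" "y \<le> 1" using that sub by auto
    have "p 1 1 + p 0 1 * x + p 1 0 * y +
        (p (-1) 1 * x\<^sup>2 + p 0 0 * x * y + p (-1) 0 * x\<^sup>2 * y + step_row p (-1) x * y\<^sup>2) = x * y"
      using zero[OF that] by (simp add: step_kernel_def step_row_def algebra_simps)
    moreover have "0 \<le> step_row p (-1) x" using row_pos[OF xy(1) south] by simp
    then have "0 \<le> p (-1) 1 * x\<^sup>2 + p 0 0 * x * y + p (-1) 0 * x\<^sup>2 * y + step_row p (-1) x * y\<^sup>2"
      using nonneg xy by simp
    moreover have "0 \<le> p 1 1" "0 \<le> p 0 1 * x" "0 \<le> p 1 0 * y" using nonneg xy by auto
    ultimately have "p 1 1 \<le> x * y" "p 0 1 * x \<le> y * x" "p 1 0 * y \<le> x * y"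
      by (simp_all add: mult.commute)
    moreover have "x * y \<le> x" using xy by simp
    moreover have "p 0 1 \<le> y" "p 1 0 \<le> x" using calculation(2,3) xy by simp_all
    ultimately show ?thesis by linarith
  qed
  have "closed {z::real \<times> real. p 1 0 \<le> fst z}" "closed {z::real \<times> real. p 0 1 \<le> snd z}"
    "closed {z::real \<times> real. p 1 1 \<le> fst z}"
    by (intro closed_Collect_le continuous_intros)+
  moreover have "\<Gamma> \<subseteq> {z. p 1 0 \<le> fst z}" "\<Gamma> \<subseteq> {z. p 0 1 \<le> snd z}" "\<Gamma> \<subseteq> {z. p 1 1 \<le> fst z}"
    using bound by auto
  ultimately have "(0, 0) \<in> {z::real \<times> real. p 1 0 \<le> fst z}" "(0, 0) \<in> {z::real \<times> real. p 0 1 \<le> snd z}"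
    "(0, 0) \<in> {z::real \<times> real. p 1 1 \<le> fst z}"
    using islimpt_closed_superset[OF lim] by blast+
  moreover have "p 1 0 \<ge> 0" "p 0 1 \<ge> 0" "p 1 1 \<ge> 0" by (rule nonneg)+
  ultimately show ?thesis by auto
qed

end

section \<open>Consequences of irreducibility\<close>

definition row_poly :: "(int \<Rightarrow> int \<Rightarrow> real) \<Rightarrow> int \<Rightarrow> real poly" where
  "row_poly p t = [:p 1 t, p 0 t, p (-1) t:]"

definition kernel_poly :: "(int \<Rightarrow> int \<Rightarrow> real) \<Rightarrow> real poly poly" where
  "kernel_poly p = [:row_poly p 1, row_poly p 0 - [:0, 1:], row_poly p (-1):]"

lemma poly_row_poly: "poly (row_poly p t) x = step_row p t x"
  by (simp add: row_poly_def step_row_def algebra_simps power2_eq_square)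

lemma Q_poly_eq: "Q_poly R = kernel_poly (p_int R)"
proof -
  have *: "{-1..1} = {-1, 0, 1::int}"
    by auto
  show ?thesis
    unfolding Q_poly_def * kernel_poly_def row_poly_def
    by (simp add: monom_altdef power2_eq_square numeral_2_eq_2 one_pCons)
qed

lemma p_int_nonneg: "p_int R s t \<ge> 0"
  by (simp add: p_int_def trans_prob_def)

lemma sum_p_int:
  assumes "homogeneous_walk R"
  shows "(\<Sum>s\<in>{-1,0,1}. \<Sum>t\<in>{-1,0,1}. p_int R s t) = 1"
proof -
  have "set_pmf (R (1, 1)) \<subseteq> {0,1,2} \<times> {0,1,2}"
  proof
    fix z assume z: "z \<in> set_pmf (R (1, 1))"
    obtain a b where ab: "z = (a, b)" by (cases z)
    have "trans_prob R (int a - 1) (int b - 1) 1 1 = pmf (R (1, 1)) (a, b)"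
      by (simp add: trans_prob_def)
    also have "\<dots> \<noteq> 0" using z ab by (simp add: set_pmf_iff)
    finally have "\<bar>int a - 1\<bar> \<le> 1 \<and> \<bar>int b - 1\<bar> \<le> 1"
      using assms unfolding homogeneous_walk_def by (meson linorder_not_le)
    then have "a \<le> 2" "b \<le> 2" by linarith+
    then show "z \<in> {0,1,2} \<times> {0,1,2}" using ab by (auto simp: le_Suc_eq numeral_2_eq_2)
  qed
  then have "sum (pmf (R (1, 1))) ({0,1,2} \<times> {0,1,2}) = 1"
    by (intro sum_pmf_eq_1) auto
  moreover have "sum (pmf (R (1, 1))) ({0,1,2} \<times> {0,1,2}) =
      (\<Sum>a\<in>{0,1,2}. \<Sum>b\<in>{0,1,2}. pmf (R (1, 1)) (a, b))"
    by (simp add: sum.cartesian_product)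
  ultimately show ?thesis
    by (simp add: p_int_def trans_prob_def)
qed

lemma quadratic_not_unit:
  fixes a b c :: "'a :: idom"
  assumes "b \<noteq> 0 \<or> c \<noteq> 0"
  shows "\<not> [:a, b, c:] dvd 1"
  using assms by (auto simp: is_unit_poly_iff)

text \<open>Each missing property makes the walk singular: without \<open>south\<close> or
  \<open>west\<close> a degree is 1, without \<open>north\<close> or \<open>east\<close> Q has the
  factor y or x, and without \<open>spanning\<close> it factors explicitly.\<close>

lemma quarter_plane_kernelI:
  assumes nonneg: "\<And>s t. p s t \<ge> 0"
    and sum_1: "(\<Sum>s\<in>{-1,0,1}. \<Sum>t\<in>{-1,0,1}. p s t) = 1"
    and irr: "irreducible (kernel_poly p)"
    and degx: "degree_x (kernel_poly p) \<noteq> 1" and degy: "degree_y (kernel_poly p) \<noteq> 1"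
  shows "quarter_plane_kernel p"
proof -
  let ?Q = "kernel_poly p"
  have Q0: "?Q \<noteq> 0" using irr by auto
  have split: "f dvd 1 \<or> g dvd 1" if "?Q = f * g" for f g
    using irreducibleD[OF irr that] .
  \<comment> \<open>Otherwise all other probabilities vanish and Q = 0. It also keeps the term in xy
    present, which makes the degrees below exactly 1.\<close>
  have p00: "p 0 0 \<noteq> 1"
  proof
    assume "p 0 0 = 1"
    moreover have "p 1 1 \<ge> 0" "p 1 0 \<ge> 0" "p 1 (-1) \<ge> 0" "p 0 1 \<ge> 0" "p 0 (-1) \<ge> 0"
      "p (-1) 1 \<ge> 0" "p (-1) 0 \<ge> 0" "p (-1) (-1) \<ge> 0" by (rule nonneg)+
    ultimately have "p 1 1 = 0 \<and> p 1 0 = 0 \<and> p 1 (-1) = 0 \<and> p 0 1 = 0 \<and> p 0 (-1) = 0 \<and>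
      p (-1) 1 = 0 \<and> p (-1) 0 = 0 \<and> p (-1) (-1) = 0"
      using sum_1 by simp
    then show False using Q0 \<open>p 0 0 = 1\<close> by (simp add: kernel_poly_def row_poly_def)
  qed
  have pos: "p s t > 0" if "p s t \<noteq> 0" for s t using nonneg[of s t] that by simp
  have south: "row_poly p (-1) \<noteq> 0"
    using degy p00 by (auto simp: degree_y_def kernel_poly_def row_poly_def)
  have west: "p (-1) 1 \<noteq> 0 \<or> p (-1) 0 \<noteq> 0 \<or> p (-1) (-1) \<noteq> 0"
  proof (rule ccontr)
    assume *: "\<not> ?thesis"
    have deg: "degree ?Q = 2"
      using south by (simp add: kernel_poly_def)
    have "degree_x ?Q = 1"
      unfolding degree_x_def deg
    proof (rule Max_eqI)
      show "1 \<in> (\<lambda>n. degree (coeff ?Q n)) ` {..2}"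
        by (rule image_eqI[of _ _ 1]) (use * p00 in \<open>auto simp: kernel_poly_def row_poly_def\<close>)
      fix d assume "d \<in> (\<lambda>n. degree (coeff ?Q n)) ` {..2}"
      then show "d \<le> 1"
        using * by (auto simp: kernel_poly_def row_poly_def coeff_pCons split: nat.splits)
    qed auto
    with degx show False by simp
  qed
  have north: "row_poly p 1 \<noteq> 0"
  proof
    assume "row_poly p 1 = 0"
    \<comment> \<open>The padding zeros give both factors the shape of
      \<open>quadratic_not_unit\<close>.\<close>
    then have "?Q = [:0, 1, 0:] * [:row_poly p 0 - [:0, 1:], row_poly p (-1), 0:]"
      by (simp add: kernel_poly_def)
    from split[OF this] show False
      using quadratic_not_unit[of "1 :: real poly" 0 0] quadratic_not_unit[of "row_poly p (-1)" 0] south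
      by auto
  qed
  have east: "p 1 1 \<noteq> 0 \<or> p 1 0 \<noteq> 0 \<or> p 1 (-1) \<noteq> 0"
  proof (rule ccontr)
    assume "\<not> ?thesis"
    then have "?Q = [:[:0, 1, 0:]:] * [:[:p 0 1, p (-1) 1:], [:p 0 0 - 1, p (-1) 0:], [:p 0 (-1), p (-1) (-1):]:]"
      by (simp add: kernel_poly_def row_poly_def)
    from split[OF this] show False
    proof
      assume "[:[:0, 1, 0:]:] dvd (1 :: real poly poly)"
      then have "[:0, 1, 0:] dvd (1 :: real poly)" by (simp only: is_unit_const_poly_iff)
      then show False using quadratic_not_unit[of "1 :: real" 0 0] by simp
    next
      assume "[:[:p 0 1, p (-1) 1:], [:p 0 0 - 1, p (-1) 0:], [:p 0 (-1), p (-1) (-1):]:] dvd 1"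
      then show False
        using quadratic_not_unit[of "[:p 0 0 - 1, p (-1) 0:]"] p00 by simp
    qed
  qed
  show ?thesis
  proof
    fix a b :: real assume ab: "a \<noteq> 0 \<or> b \<noteq> 0"
    show "\<exists>s\<in>{-1,0,1}. \<exists>t\<in>{-1,0,1}. p s t > 0 \<and> s * a + t * b \<noteq> 0"
    proof (rule ccontr)
      assume "\<not> ?thesis"
      then have z: "p s t = 0" if "s \<in> {-1,0,1}" "t \<in> {-1,0,1}" "s * a + t * b \<noteq> 0" for s t :: int
        using that pos by blast
      have a: "a \<noteq> 0"
      proof
        assume "a = 0"
        then have "row_poly p (-1) = 0" using z ab by (simp add: row_poly_def)
        with south show False by simp
      qed
      have b: "b \<noteq> 0"
      proof
        assume "b = 0"
        then show False using z[of "-1" 1] z[of "-1" 0] z[of "-1" "-1"] west ab by simp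
      qed
      have zero: "p 1 0 = 0" "p 0 1 = 0" "p (-1) 0 = 0" "p 0 (-1) = 0"
        using z a b by simp_all
      show False
      proof (cases "a = b")
        case True
        then have "p 1 1 = 0" "p (-1) (-1) = 0" using z b by simp_all
        \<comment> \<open>Only the antidiagonal steps and the null step remain, and Q splits off y -
          x because the probabilities sum to 1.\<close>
        then have "?Q = [:[:0, -1:], 1, 0:] * [:[:0, - p (-1) 1:], [:p 1 (-1):], 0:]"
          using zero sum_1 by (simp add: kernel_poly_def row_poly_def)
        from split[OF this] show False
          using quadratic_not_unit[of 1 0 "[:0, -1:]"] quadratic_not_unit[of "[:p 1 (-1):]" 0] south zero \<open>p (-1) (-1) = 0\<close>
          by (auto simp: row_poly_def)
      next
        case False
        then have "p 1 (-1) = 0" "p (-1) 1 = 0" using z by simp_all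
        \<comment> \<open>With steps on the main diagonal only, Q is a quadratic in xy with root
          1.\<close>
        then have "?Q = [:-1, [:0, 1:], 0:] * [:[:- p 1 1:], [:0, p (-1) (-1):], 0:]"
          using zero sum_1 by (simp add: kernel_poly_def row_poly_def)
        from split[OF this] show False
          using quadratic_not_unit[of "[:0, 1:]" 0 "-1"] quadratic_not_unit[of "[:0, p (-1) (-1):]" 0] west zero \<open>p (-1) 1 = 0\<close>
          by auto
      qed
    qed
  qed (use nonneg sum_1 south north west east pos in \<open>auto simp: row_poly_def\<close>)
qed

section \<open>Common zeros of the kernel and a boundary form\<close>

text \<open>Reads \<open>f\<close> as a polynomial in the outer variable y, which allows Q to be
  written as a quadratic in x.\<close>

definition lift_poly :: "real poly \<Rightarrow> real poly poly" where
  "lift_poly f = map_poly (\<lambda>c. [:c:]) f"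

lemma lift_poly_0 [simp]: "lift_poly 0 = 0"
  and lift_poly_pCons [simp]: "lift_poly (pCons a f) = pCons [:a:] (lift_poly f)"
  by (simp_all add: lift_poly_def map_poly_pCons)

lemma lift_poly_add: "lift_poly (f + g) = lift_poly f + lift_poly g"
  and lift_poly_diff: "lift_poly (f - g) = lift_poly f - lift_poly g"
  and lift_poly_smult: "lift_poly (smult a f) = smult [:a:] (lift_poly f)"
  by (auto intro!: poly_eqI simp: lift_poly_def coeff_map_poly mult.commute)

lemma lift_poly_mult: "lift_poly (f * g) = lift_poly f * lift_poly g"
  by (induction f) (simp_all add: lift_poly_add lift_poly_smult)

lemma poly_lift_poly: "poly (lift_poly f) [:c:] = [:poly f c:]"
  by (induction f) (simp_all add: algebra_simps)

text \<open>The hypothesis says that -b/a is a root of the quadratic, with denominators cleared; the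
  sum of the roots gives the second factor.\<close>

lemma quadratic_times_lead:
  fixes a b c d X :: "'a :: comm_ring_1"
  assumes "b\<^sup>2 - b * c + d * a = 0"
  shows "a * (a * X\<^sup>2 + c * X + d) = (a * X + b) * (a * X + (c - b))"
proof -
  have "a * (a * X\<^sup>2 + c * X + d) = (a * X + b) * (a * X + (c - b)) + (b\<^sup>2 - b * c + d * a)"
    by (simp add: algebra_simps power2_eq_square)
  with assms show ?thesis by simp
qed

text \<open>If a linear form in \<open>y\<close> shares infinitely many zeros with the kernel, then the resultant
  vanishes and \<open>quadratic_times_lead\<close> factors a multiple of the kernel into forms linear in \<open>y\<close>.\<close>

lemma finite_common_zeros_y:
  assumes irr: "irreducible (kernel_poly p)" and "quarter_plane_kernel p"
  shows "finite {(x, y). 0 < x \<and> step_kernel p x y = 0 \<and> step_row p (-1) x * y + poly B x = 0}"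
proof -
  interpret quarter_plane_kernel p by fact
  define A a0 a1 where "A = row_poly p (-1)" "a0 = row_poly p 0 - [:0, 1:]" "a1 = row_poly p 1"
  note defs = this
  \<comment> \<open>The resultant in y of Q and A y + B is A D.\<close>
  define D where "D = B\<^sup>2 - B * a0 + a1 * A"
  have A: "A \<noteq> 0"
    using row_pos[OF zero_less_one south] poly_row_poly[of p "-1" 1] by (auto simp: defs)
  have Q: "kernel_poly p = [:A:] * [:0, 1:]\<^sup>2 + [:a0:] * [:0, 1:] + [:a1:]"
    by (simp add: kernel_poly_def defs power2_eq_square)
  have deg: "degree (kernel_poly p) = 2"
    using A by (simp add: kernel_poly_def defs)
  have "D \<noteq> 0"
  proof
    assume "D = 0"
    then have "[:B:]\<^sup>2 - [:B:] * [:a0:] + [:a1:] * [:A:] = 0"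
      by (simp add: D_def power2_eq_square mult.commute)
    \<comment> \<open>The product equals A Q; Q is prime, so it would divide a factor of smaller
      degree in y.\<close>
    then have "kernel_poly p dvd ([:A:] * [:0, 1:] + [:B:]) * ([:A:] * [:0, 1:] + ([:a0:] - [:B:]))"
      unfolding Q by (metis dvd_triv_right quadratic_times_lead)
    then have "kernel_poly p dvd [:A:] * [:0, 1:] + [:B:] \<or>
        kernel_poly p dvd [:A:] * [:0, 1:] + ([:a0:] - [:B:])"
      by (rule prime_elem_dvd_multD[OF irreducible_imp_prime_elem[OF irr]])
    then obtain C where "kernel_poly p dvd [:C, A:]"
      by auto
    from dvd_imp_degree_le[OF this] A deg show False by simp
  qed
  then have "finite {x. poly D x = 0}" by (rule poly_roots_finite)
  moreover have "{(x, y). 0 < x \<and> step_kernel p x y = 0 \<and> step_row p (-1) x * y + poly B x = 0}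
      \<subseteq> (\<lambda>x. (x, - poly B x / step_row p (-1) x)) ` {x. poly D x = 0}"
  proof safe
    fix x y assume *: "0 < x" "step_kernel p x y = 0" "step_row p (-1) x * y + poly B x = 0"
    \<comment> \<open>D is a combination of Q and the boundary form, so it vanishes at their common
      zeros; the linear form then determines y from x.\<close>
    have "poly D x = step_row p (-1) x * step_kernel p x y +
        (step_row p (-1) x * y + poly B x) * (poly B x - step_row p (-1) x * y - step_row p 0 x + x)"
      by (simp add: D_def defs poly_row_poly step_kernel_def algebra_simps power2_eq_square)
    with * have "poly D x = 0" by simp
    moreover have "y = - poly B x / step_row p (-1) x"
      using * row_pos[OF *(1) south] by (simp add: field_simps)
    ultimately show "(x, y) \<in> (\<lambda>x. (x, - poly B x / step_row p (-1) x)) ` {x. poly D x = 0}" by blast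
  qed
  ultimately show ?thesis using finite_surj by blast
qed

text \<open>The transposed statement does not follow by symmetry, because the two variables play
  different roles in \<open>real poly poly\<close>.\<close>

lemma finite_common_zeros_x:
  assumes irr: "irreducible (kernel_poly p)" and "quarter_plane_kernel p"
  shows "finite {(x, y). 0 < y \<and> step_kernel p x y = 0 \<and> step_row (transp_steps p) (-1) y * x + poly B y = 0}"
proof -
  interpret quarter_plane_kernel p by fact
  interpret T: quarter_plane_kernel "transp_steps p" by (rule transp)
  define A a0 a1 where "A = row_poly (transp_steps p) (-1)"
    "a0 = row_poly (transp_steps p) 0 - [:0, 1:]" "a1 = row_poly (transp_steps p) 1"
  note defs = this
  define D where "D = B\<^sup>2 - B * a0 + a1 * A"
  define X :: "real poly poly" where "X = [:[:0, 1:]:]"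
  have A: "poly A 1 \<noteq> 0"
    using T.row_pos[OF zero_less_one T.south] by (simp add: defs poly_row_poly)
  have Q: "kernel_poly p = lift_poly A * X\<^sup>2 + lift_poly a0 * X + lift_poly a1"
    by (simp add: kernel_poly_def defs power2_eq_square row_poly_def X_def)
  have "D \<noteq> 0"
  proof
    assume "D = 0"
    then have "lift_poly (B\<^sup>2 - B * a0 + a1 * A) = 0"
      by (simp add: D_def)
    then have "(lift_poly B)\<^sup>2 - lift_poly B * lift_poly a0 + lift_poly a1 * lift_poly A = 0"
      by (simp add: lift_poly_add lift_poly_diff lift_poly_mult power2_eq_square)
    then have "kernel_poly p dvd (lift_poly A * X + lift_poly B) * (lift_poly A * X + (lift_poly a0 - lift_poly B))"
      unfolding Q by (metis dvd_triv_right quadratic_times_lead)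
    then have "kernel_poly p dvd lift_poly A * X + lift_poly B \<or>
        kernel_poly p dvd lift_poly A * X + (lift_poly a0 - lift_poly B)"
      by (rule prime_elem_dvd_multD[OF irreducible_imp_prime_elem[OF irr]])
    then obtain C where "kernel_poly p dvd lift_poly A * X + lift_poly C"
      by (metis lift_poly_diff)
    \<comment> \<open>Setting y = 1 leaves polynomials in x of degrees 2 and 1, since A(1) is
      nonzero.\<close>
    then have "poly (kernel_poly p) [:1:] dvd poly (lift_poly A * X + lift_poly C) [:1:]"
      by (metis dvd_def poly_mult)
    then have "[:poly a1 1, poly a0 1, poly A 1:] dvd [:poly C 1, poly A 1:]"
      unfolding Q by (simp add: poly_lift_poly X_def power2_eq_square del: pCons_one)
    from dvd_imp_degree_le[OF this] A show False by simp
  qed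
  then have "finite {y. poly D y = 0}" by (rule poly_roots_finite)
  moreover have "{(x, y). 0 < y \<and> step_kernel p x y = 0 \<and> step_row (transp_steps p) (-1) y * x + poly B y = 0}
      \<subseteq> (\<lambda>y. (- poly B y / step_row (transp_steps p) (-1) y, y)) ` {y. poly D y = 0}"
  proof safe
    fix x y assume *: "0 < y" "step_kernel p x y = 0" "step_row (transp_steps p) (-1) y * x + poly B y = 0"
    let ?r = "step_row (transp_steps p)"
    have "poly D y = ?r (-1) y * step_kernel (transp_steps p) y x +
        (?r (-1) y * x + poly B y) * (poly B y - ?r (-1) y * x - ?r 0 y + y)"
      by (simp add: D_def defs poly_row_poly step_kernel_def algebra_simps power2_eq_square)
    with * have "poly D y = 0" by (simp add: kernel_transp)
    moreover have "x = - poly B y / ?r (-1) y"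
      using * T.row_pos[OF *(1) T.south] by (simp add: field_simps)
    ultimately show "(x, y) \<in> (\<lambda>y. (- poly B y / ?r (-1) y, y)) ` {y. poly D y = 0}" by blast
  qed
  ultimately show ?thesis using finite_surj by blast
qed

section \<open>Balance equations as moment equations\<close>

text \<open>In the balance equation at (i + 1, j + 1) the monomial x^i y^j factors out and leaves Q.
  The shift by 1 keeps all exponents nonnegative.\<close>

lemma interior_moments:
  assumes inv: "invariant_measure R m"
    and m: "\<And>i j. ((\<lambda>z. \<alpha> z * fst z ^ i * snd z ^ j) has_sum m (i, j)) \<Gamma>"
  shows "((\<lambda>z. \<alpha> z * step_kernel (p_int R) (fst z) (snd z) * fst z ^ i * snd z ^ j) has_sum 0) \<Gamma>"
proof -
  have I: "{-1..1} = {-1, 0, 1::int}" by auto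
  define T where "T a b z = \<alpha> z * fst z ^ nat (int (Suc i) - a) * snd z ^ nat (int (Suc j) - b)"
    for a b z
  have "((\<lambda>z. (\<Sum>s\<in>{-1..1}. \<Sum>t\<in>{-1..1}. T s t z * p_int R s t) - T 0 0 z) has_sum
      ((\<Sum>s\<in>{-1..1}. \<Sum>t\<in>{-1..1}. m (nat (int (Suc i) - s), nat (int (Suc j) - t)) * p_int R s t)
        - m (nat (int (Suc i) - 0), nat (int (Suc j) - 0)))) \<Gamma>"
    unfolding T_def by (intro has_sum_diff has_sum_finite_sum has_sum_cmult_left m) auto
  moreover have "m (Suc i, Suc j) =
      (\<Sum>s\<in>{-1..1}. \<Sum>t\<in>{-1..1}. m (nat (int (Suc i) - s), nat (int (Suc j) - t)) * p_int R s t)"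
    using inv unfolding invariant_measure_def by blast
  moreover have "(\<Sum>s\<in>{-1..1}. \<Sum>t\<in>{-1..1}. T s t z * p_int R s t) - T 0 0 z =
      \<alpha> z * step_kernel (p_int R) (fst z) (snd z) * fst z ^ i * snd z ^ j" for z
    unfolding I T_def step_kernel_def step_row_def
    by (simp add: nat_add_distrib algebra_simps power2_eq_square)
  ultimately show ?thesis by (simp add: nat_add_distrib)
qed

text \<open>The balance equation at (i + 1, 0) has the common factor x^i. Row 1 supplies the term
  linear in y, row 0 the polynomial in x.\<close>

lemma horizontal_moments:
  assumes inv: "invariant_measure R m"
    and m: "\<And>i j. ((\<lambda>z. \<alpha> z * fst z ^ i * snd z ^ j) has_sum m (i, j)) \<Gamma>"
  shows "((\<lambda>z. \<alpha> z * (step_row (p_int R) (-1) (fst z) * snd z +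
      poly [:p_hor R 1, p_hor R 0 - 1, p_hor R (-1):] (fst z)) * fst z ^ i) has_sum 0) \<Gamma>"
proof -
  have I: "{-1..1} = {-1, 0, 1::int}" by auto
  define T where "T a b z = \<alpha> z * fst z ^ nat (int (Suc i) - a) * snd z ^ b" for a b z
  have "((\<lambda>z. (\<Sum>s\<in>{-1..1}. T s 1 z * p_int R s (-1)) + (\<Sum>s\<in>{-1..1}. T s 0 z * p_hor R s)
        - T 0 0 z) has_sum
      ((\<Sum>s\<in>{-1..1}. m (nat (int (Suc i) - s), 1) * p_int R s (-1)) +
       (\<Sum>s\<in>{-1..1}. m (nat (int (Suc i) - s), 0) * p_hor R s)
        - m (nat (int (Suc i) - 0), 0))) \<Gamma>"
    unfolding T_def by (intro has_sum_diff has_sum_add has_sum_finite_sum has_sum_cmult_left m) auto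
  moreover have "m (Suc i, 0) = (\<Sum>s\<in>{-1..1}. m (nat (int (Suc i) - s), 1) * p_int R s (-1)) +
       (\<Sum>s\<in>{-1..1}. m (nat (int (Suc i) - s), 0) * p_hor R s)"
    using inv unfolding invariant_measure_def by blast
  moreover have "(\<Sum>s\<in>{-1..1}. T s 1 z * p_int R s (-1)) + (\<Sum>s\<in>{-1..1}. T s 0 z * p_hor R s) - T 0 0 z =
      \<alpha> z * (step_row (p_int R) (-1) (fst z) * snd z +
        poly [:p_hor R 1, p_hor R 0 - 1, p_hor R (-1):] (fst z)) * fst z ^ i" for z
    unfolding I T_def step_row_def
    by (simp add: nat_add_distrib algebra_simps power2_eq_square)
  ultimately show ?thesis by (simp add: nat_add_distrib)
qed

lemma vertical_moments:
  assumes inv: "invariant_measure R m"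
    and m: "\<And>i j. ((\<lambda>z. \<alpha> z * fst z ^ i * snd z ^ j) has_sum m (i, j)) \<Gamma>"
  shows "((\<lambda>z. \<alpha> z * (step_row (transp_steps (p_int R)) (-1) (snd z) * fst z +
      poly [:p_ver R 1, p_ver R 0 - 1, p_ver R (-1):] (snd z)) * snd z ^ j) has_sum 0) \<Gamma>"
proof -
  have I: "{-1..1} = {-1, 0, 1::int}" by auto
  define T where "T a b z = \<alpha> z * fst z ^ a * snd z ^ nat (int (Suc j) - b)" for a b z
  have "((\<lambda>z. (\<Sum>t\<in>{-1..1}. T 1 t z * p_int R (-1) t) + (\<Sum>t\<in>{-1..1}. T 0 t z * p_ver R t)
        - T 0 0 z) has_sum
      ((\<Sum>t\<in>{-1..1}. m (1, nat (int (Suc j) - t)) * p_int R (-1) t) +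
       (\<Sum>t\<in>{-1..1}. m (0, nat (int (Suc j) - t)) * p_ver R t)
        - m (0, nat (int (Suc j) - 0)))) \<Gamma>"
    unfolding T_def by (intro has_sum_diff has_sum_add has_sum_finite_sum has_sum_cmult_left m) auto
  moreover have "m (0, Suc j) = (\<Sum>t\<in>{-1..1}. m (1, nat (int (Suc j) - t)) * p_int R (-1) t) +
       (\<Sum>t\<in>{-1..1}. m (0, nat (int (Suc j) - t)) * p_ver R t)"
    using inv unfolding invariant_measure_def by blast
  moreover have "(\<Sum>t\<in>{-1..1}. T 1 t z * p_int R (-1) t) + (\<Sum>t\<in>{-1..1}. T 0 t z * p_ver R t) - T 0 0 z =
      \<alpha> z * (step_row (transp_steps (p_int R)) (-1) (snd z) * fst z +
        poly [:p_ver R 1, p_ver R 0 - 1, p_ver R (-1):] (snd z)) * snd z ^ j" for z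
    unfolding I T_def step_row_def
    by (simp add: nat_add_distrib algebra_simps power2_eq_square)
  ultimately show ?thesis by (simp add: nat_add_distrib)
qed

section \<open>From the balance equations to the accumulation points\<close>

theorem theorem20:
  fixes R :: walk
    and m :: "nat \<times> nat \<Rightarrow> real"
    and \<Gamma> :: "(real \<times> real) set"
    and \<alpha> :: "real \<times> real \<Rightarrow> real"
  assumes "homogeneous_walk R"
    and "\<not> singular_walk R"
    and "irreducible_chain R"
    and "aperiodic_chain R"
    and "positive_recurrent_chain R"
    and "\<Gamma> \<subseteq> {0<..<1} \<times> {0<..<1}"
    and "\<And>\<rho> \<sigma>. (\<rho>, \<sigma>) \<in> \<Gamma> \<Longrightarrow>
           \<exists>w v. w \<ge> 1 \<and> v \<ge> 1 \<and>
             (\<forall>(\<rho>', \<sigma>') \<in> \<Gamma> - {(\<rho>, \<sigma>)}. \<rho>' ^ w * \<sigma>' ^ v \<noteq> \<rho> ^ w * \<sigma> ^ v)"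
    and "infinite \<Gamma>"
    and "\<And>\<rho> \<sigma>. (\<rho>, \<sigma>) \<in> \<Gamma> \<Longrightarrow> \<alpha> (\<rho>, \<sigma>) \<noteq> 0"
    and "(\<lambda>(\<rho>, \<sigma>). \<bar>\<alpha> (\<rho>, \<sigma>)\<bar> * (1 / (1 - \<rho>)) * (1 / (1 - \<sigma>))) summable_on \<Gamma>"
    and "invariant_measure R m"
    and "\<And>i j. m (i, j) = (\<Sum>\<^sub>\<infinity>(\<rho>, \<sigma>)\<in>\<Gamma>. \<alpha> (\<rho>, \<sigma>) * \<rho> ^ i * \<sigma> ^ j)"
  shows "p_int R 1 0 = 0 \<and> p_int R 1 1 = 0 \<and> p_int R 0 1 = 0 \<and>
         (0, 0) islimpt \<Gamma> \<and> (\<forall>z. z islimpt \<Gamma> \<longrightarrow> z = (0, 0))"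
proof -
  define p where "p = p_int R"
  have irr: "irreducible (kernel_poly p)" and deg: "degree_x (kernel_poly p) \<noteq> 1"
    "degree_y (kernel_poly p) \<noteq> 1"
    using assms(2) by (simp_all add: singular_walk_def Q_poly_eq p_def)
  interpret quarter_plane_kernel p
  proof (rule quarter_plane_kernelI[OF _ _ irr deg])
    show "(\<Sum>s\<in>{-1,0,1}. \<Sum>t\<in>{-1,0,1}. p s t) = 1"
      unfolding p_def by (rule sum_p_int[OF assms(1)])
  qed (simp add: p_def p_int_nonneg)
  \<comment> \<open>The given summability dominates every moment, because x^i \<le> 1 \<le> 1 / (1 -
    x).\<close>
  have m: "((\<lambda>z. \<alpha> z * fst z ^ i * snd z ^ j) has_sum m (i, j)) \<Gamma>" for i j
  proof -
    have "(\<lambda>z. \<alpha> z * fst z ^ i * snd z ^ j) summable_on \<Gamma>"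
    proof (rule summable_on_iff_abs_summable_on_real [THEN iffD2],
        rule Infinite_Sum.abs_summable_on_comparison_test' [OF assms(10)])
      fix z assume "z \<in> \<Gamma>"
      obtain x y where z: "z = (x, y)" by (cases z)
      then have xy: "0 < x" "x < 1" "0 < y" "y < 1" using \<open>z \<in> \<Gamma>\<close> assms(6) by auto
      have "x ^ i \<le> 1" "y ^ j \<le> 1" using xy by (auto simp: power_le_one)
      moreover have "1 \<le> 1 / (1 - x)" "1 \<le> 1 / (1 - y)" using xy by auto
      ultimately have "x ^ i \<le> 1 / (1 - x)" "y ^ j \<le> 1 / (1 - y)" by linarith+
      then have "\<bar>\<alpha> z\<bar> * x ^ i * y ^ j \<le> \<bar>\<alpha> z\<bar> * (1 / (1 - x)) * (1 / (1 - y))"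
        using xy by (intro mult_mono) auto
      then show "norm (\<alpha> z * fst z ^ i * snd z ^ j) \<le>
          (case z of (\<rho>, \<sigma>) \<Rightarrow> \<bar>\<alpha> (\<rho>, \<sigma>)\<bar> * (1 / (1 - \<rho>)) * (1 / (1 - \<sigma>)))"
        using xy by (simp add: z abs_mult power_abs)
    qed
    moreover have "m (i, j) = infsum (\<lambda>z. \<alpha> z * fst z ^ i * snd z ^ j) \<Gamma>"
      using assms(12) by (simp add: case_prod_unfold)
    ultimately show ?thesis by simp
  qed
  have unit: "\<Gamma> \<subseteq> {0..1} \<times> {0..1}" using assms(6) by auto
  have zero: "step_kernel p x y = 0" if "(x, y) \<in> \<Gamma>" for x y
    using double_moments_eq_0[OF unit that, of "\<lambda>z. \<alpha> z * step_kernel p (fst z) (snd z)"]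
      interior_moments[OF assms(11) m] assms(9)[OF that] by (simp add: p_def)
  define H V where "H = [:p_hor R 1, p_hor R 0 - 1, p_hor R (-1):]"
    and "V = [:p_ver R 1, p_ver R 0 - 1, p_ver R (-1):]"
  \<comment> \<open>The exceptional points: zeros of Q where the horizontal or the vertical boundary
    form vanishes as well.\<close>
  define E where "E = {(x, y). 0 < x \<and> step_kernel p x y = 0 \<and> step_row p (-1) x * y + poly H x = 0} \<union>
    {(x, y). 0 < y \<and> step_kernel p x y = 0 \<and> step_row (transp_steps p) (-1) y * x + poly V y = 0}"
  have E: "finite E"
    unfolding E_def using finite_common_zeros_y finite_common_zeros_x irr quarter_plane_kernel_axioms
    by blast
  \<comment> \<open>If a point is alone on its line, the level-set sum of the boundary form has a
    single term. As \<alpha> is nonzero there, the form vanishes and the point lies in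
    \<open>E\<close>.\<close>
  have mates: "(\<exists>x'. x' \<noteq> x \<and> (x', y) \<in> \<Gamma>) \<and> (\<exists>y'. y' \<noteq> y \<and> (x, y') \<in> \<Gamma>)"
    if "(x, y) \<in> \<Gamma> - E" for x y
  proof (intro conjI; rule ccontr)
    have xy: "(x, y) \<in> \<Gamma>" "0 < x" "x < 1" "0 < y" "y < 1" using that assms(6) by auto
    {
      assume "\<not> (\<exists>x'. x' \<noteq> x \<and> (x', y) \<in> \<Gamma>)"
      then have "{z \<in> \<Gamma>. snd z = y} = {(x, y)}" using xy by auto
      moreover have "((\<lambda>z. \<alpha> z * (step_row (transp_steps p) (-1) (snd z) * fst z + poly V (snd z)))
          has_sum 0) {z \<in> \<Gamma>. snd z = y}"
        unfolding p_def V_def using unit xy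
        by (intro level_set_sum_eq_0[where f = snd] vertical_moments[OF assms(11) m]) auto
      ultimately have "\<alpha> (x, y) * (step_row (transp_steps p) (-1) y * x + poly V y) = 0"
        using has_sum_0_singletonD by fastforce
      then show False using assms(9)[OF xy(1)] that zero xy by (simp add: E_def)
    }
    {
      assume "\<not> (\<exists>y'. y' \<noteq> y \<and> (x, y') \<in> \<Gamma>)"
      then have "{z \<in> \<Gamma>. fst z = x} = {(x, y)}" using xy by auto
      moreover have "((\<lambda>z. \<alpha> z * (step_row p (-1) (fst z) * snd z + poly H (fst z)))
          has_sum 0) {z \<in> \<Gamma>. fst z = x}"
        unfolding p_def H_def using unit xy
        by (intro level_set_sum_eq_0[where f = fst] horizontal_moments[OF assms(11) m]) auto
      ultimately have "\<alpha> (x, y) * (step_row p (-1) x * y + poly H x) = 0"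
        using has_sum_0_singletonD by fastforce
      then show False using assms(9)[OF xy(1)] that zero xy by (simp add: E_def)
    }
  qed
  have lim: "(0, 0) islimpt \<Gamma> \<and> (\<forall>z. z islimpt \<Gamma> \<longrightarrow> z = (0, 0))"
    using limit_points_origin[OF assms(6,8) zero]
      finite_away_from_axes[OF assms(6,8) zero E mates] by blast
  then have "p 1 0 = 0 \<and> p 1 1 = 0 \<and> p 0 1 = 0"
    using no_northeast_steps[OF assms(6) zero] by blast
  with lim show ?thesis by (simp add: p_def)
qed

end
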